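(* Let $d\ge 1$ be odd, let $G=(V,E)$ be a finite simple graph which is a geometric graph of dimension $d$, and let $f:V\to\mathbb{R}$ be an injective function. Then the symmetric index satisfies $j_f(x)=0$ for all $x\in V$.
   Context: For a finite simple graph $H$, let $v_k(H)$ be the number of complete subgraphs $K_{k+1}$ of $H$; the Euler characteristic is $\chi(H)=\sum_{k\ge 0}(-1)^k v_k(H)$ (so $\chi(\emptyset)=0$). For a vertex $x$, the unit sphere $S(x)$ is the subgraph induced by the neighbors of $x$. Dimension (inductive): $\dim(\emptyset)=-1$; for a vertex $x$ of a nonempty graph $\dim(x)=1+\dim(S(x))$; and $\dim(H)$ is the average of $\dim(x)$ over the vertices $x$ of $H$. Geometric graphs (inductive): a graph is a geometric graph of dimension $1$ if $\dim(x)=1$ and $\chi(S(x))=2$ for every vertex $x$. For $d\ge2$, a graph is a geometric graph of dimension $d$ if $\dim(x)=d$ for every vertex $x$ and each unit sphere $S(x)$ is a geometric graph of dimension $d-1$ satisfying $\chi(S(x))=1-(-1)^d$. Index: for injective $f:V\to\mathbb{R}$, let $S^-_f(x)$ be the subgraph of $S(x)$ induced by $\{y\in S(x): f(y)<f(x)\}$, put $i_f(x)=1-\chi(S^-_f(x))$, and define $j_f(x)=\frac{1}{2}(i_f(x)+i_{-f}(x))$. *)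

theory Defs
  imports Complex_Main "Graph_Theory.Graph_Theory"
begin

text \<open>
  Finite simple graphs are represented by the locale predicate \<open>graph\<close> of the entry
  \<open>Graph_Theory\<close>: finite, loop-free, without parallel arcs, and symmetric, so that every
  undirected edge is a pair of opposite arcs. Induced subgraphs (\<open>\<restriction>\<close>), subgraphs and complete
  graphs (\<open>K\<^bsub>n\<^esub>\<close>) are those of that entry.
\<close>

definition num_complete :: "nat \<Rightarrow> ('a, 'b) pre_digraph \<Rightarrow> nat" where
  "num_complete k H = card {K. subgraph K H \<and> K\<^bsub>k + 1\<^esub> K}"

text \<open>
  Only finitely many terms of the sum over all \<open>k \<ge> 0\<close> are nonzero: see
  \<open>num_complete_eq_0\<close> below.
\<close>

definition euler_char :: "('a, 'b) pre_digraph \<Rightarrow> int" where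
  "euler_char H = (\<Sum>k < card (verts H). (-1) ^ k * int (num_complete k H))"

lemma num_complete_eq_0:
  assumes "finite (verts H)" and "card (verts H) \<le> k"
  shows "num_complete k H = 0"
proof -
  have "\<not> (subgraph K H \<and> K\<^bsub>k + 1\<^esub> K)" for K
    using assms card_mono[of "verts H" "verts K"]
    by (fastforce simp: complete_digraph_def subgraph_def)
  then show ?thesis unfolding num_complete_def by (metis (mono_tags, lifting) card.empty empty_Collect_eq)
qed

lemma euler_char_empty: "verts H = {} \<Longrightarrow> euler_char H = 0"
  by (simp add: euler_char_def)

definition unit_sphere :: "('a, 'b) pre_digraph \<Rightarrow> 'a \<Rightarrow> ('a, 'b) pre_digraph" where
  "unit_sphere H x = H \<restriction> {y. x \<rightarrow>\<^bsub>H\<^esub> y}"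

lemma (in graph) graph_unit_sphere: "graph (unit_sphere G x)"
proof -
  have "induced_subgraph (unit_sphere G x) G"
    unfolding unit_sphere_def by (rule induced_induce) (auto simp: adj_in_verts)
  moreover from this have "digraph (unit_sphere G x)" by (rule digraphI_induced)
  ultimately show ?thesis
    by (auto simp: graph_def pseudo_graph_def digraph_def intro: induced_graph_imp_symmetric
        induced_graph_imp_graph sym_digraph.axioms)
qed

lemma (in graph) verts_unit_sphere_psubset:
  assumes "x \<in> verts G"
  shows "verts (unit_sphere G x) \<subset> verts G"
proof -
  have "x \<notin> verts (unit_sphere G x)"
    by (auto simp: unit_sphere_def dest: adj_not_same)
  moreover have "verts (unit_sphere G x) \<subseteq> verts G"
    by (auto simp: unit_sphere_def)
  ultimately show ?thesis using assms by blast
qed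

text \<open>
  The test \<open>graph H\<close> only serves to make the recursion terminate; outside finite simple
  graphs the value is irrelevant.
\<close>

function graph_dim :: "('a, 'b) pre_digraph \<Rightarrow> real" where
  "graph_dim H =
    (if graph H \<and> verts H \<noteq> {}
     then (\<Sum>x\<in>verts H. 1 + graph_dim (unit_sphere H x)) / real (card (verts H))
     else - 1)"
  by pat_completeness auto
termination
proof (relation "measure (\<lambda>H. card (verts H))", goal_cases)
  case 1
  show ?case by simp
next
  case (2 H x)
  then interpret graph H by simp
  show ?case using 2 verts_unit_sphere_psubset[of x] by (auto intro: psubset_card_mono)
qed

declare graph_dim.simps [simp del]

definition vertex_dim :: "('a, 'b) pre_digraph \<Rightarrow> 'a \<Rightarrow> real" where
  "vertex_dim H x = 1 + graph_dim (unit_sphere H x)"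

lemma graph_dim_empty: "verts H = {} \<Longrightarrow> graph_dim H = - 1"
  by (simp add: graph_dim.simps)

lemma graph_dim_average:
  assumes "graph H" and "verts H \<noteq> {}"
  shows "graph_dim H = (\<Sum>x\<in>verts H. vertex_dim H x) / real (card (verts H))"
  using assms by (subst graph_dim.simps) (simp add: vertex_dim_def)

inductive geometric_graph :: "nat \<Rightarrow> ('a, 'b) pre_digraph \<Rightarrow> bool" where
  dim_1: "geometric_graph 1 H"
    if "\<forall>x\<in>verts H. vertex_dim H x = 1 \<and> euler_char (unit_sphere H x) = 2"
| dim_ge_2: "geometric_graph d H"
    if "d \<ge> 2"
      and "\<forall>x\<in>verts H. vertex_dim H x = real d \<and> geometric_graph (d - 1) (unit_sphere H x)
             \<and> euler_char (unit_sphere H x) = 1 - (-1) ^ d"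

definition lower_sphere ::
    "('a, 'b) pre_digraph \<Rightarrow> ('a \<Rightarrow> real) \<Rightarrow> 'a \<Rightarrow> ('a, 'b) pre_digraph" where
  "lower_sphere G f x = unit_sphere G x \<restriction> {y \<in> verts (unit_sphere G x). f y < f x}"

definition index :: "('a, 'b) pre_digraph \<Rightarrow> ('a \<Rightarrow> real) \<Rightarrow> 'a \<Rightarrow> int" where
  "index G f x = 1 - euler_char (lower_sphere G f x)"

definition symmetric_index :: "('a, 'b) pre_digraph \<Rightarrow> ('a \<Rightarrow> real) \<Rightarrow> 'a \<Rightarrow> real" where
  "symmetric_index G f x = 1 / 2 * (of_int (index G f x) + of_int (index G (\<lambda>y. - f y) x))"

end

(* In a geometric graph of dimension d, induction on d through unit spheres shows that for every
   nonempty clique s the cliques t containing s satisfy sum (-1)^|t| = (-1)^(d+1). For d odd this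
   says that in S(x) every clique s, including the empty one, has the corresponding sum equal
   to -1. Double counting then gives the duality e(B) = - e(A) for every partition of the vertices
   of S(x) into A and B, where e sums (-1)^|t| over all cliques t inside the given set. With A and B
   the parts where f is below and above f(x), e(A) and e(B) are the indices of f and -f at x. *)

theory Submission
  imports Defs
begin

section \<open>Alternating sums over set families closed under subsets\<close>

lemma sum_Pow_minus_one_card:
  assumes "finite A"
  shows "(\<Sum>s\<in>Pow A. (-1) ^ card s) = (if A = {} then 1 else (0::int))"
  using assms
proof (induction rule: finite_induct)
  case (insert a A)
  have "(\<Sum>s\<in>Pow (insert a A). (-1) ^ card s) =
      (\<Sum>s\<in>Pow A. (-1) ^ card s) + (\<Sum>s\<in>insert a ` Pow A. (-1::int) ^ card s)"
    unfolding Pow_insert using insert by (intro sum.union_disjoint) auto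
  also have "(\<Sum>s\<in>insert a ` Pow A. (-1::int) ^ card s) = (\<Sum>s\<in>Pow A. (-1) ^ card (insert a s))"
    using insert.hyps by (intro sum.reindex_cong[OF _ refl refl]) (auto simp: inj_on_def)
  also have "\<dots> = (\<Sum>s\<in>Pow A. - ((-1) ^ card s))"
  proof (intro sum.cong refl)
    fix s assume "s \<in> Pow A"
    then have "finite s" "a \<notin> s" using insert.hyps finite_subset by auto
    then show "(-1::int) ^ card (insert a s) = - ((-1) ^ card s)" by simp
  qed
  finally show ?case by (simp add: sum_negf)
qed simp

text \<open>
  Double counting of the pairs \<open>s \<subseteq> t\<close> with \<open>s \<subseteq> A\<close>: a fixed \<open>t\<close> contributes only if
  it avoids \<open>A\<close>.
\<close>

lemma alternating_sum_avoiding: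
  fixes c :: int
  assumes "finite C" and "\<And>s. s \<in> C \<Longrightarrow> finite s"
    and down: "\<And>s t. t \<in> C \<Longrightarrow> s \<subseteq> t \<Longrightarrow> s \<in> C"
    and star: "\<And>s. s \<in> C \<Longrightarrow> (\<Sum>t | t \<in> C \<and> s \<subseteq> t. (-1) ^ card t) = c"
  shows "(\<Sum>t | t \<in> C \<and> t \<inter> A = {}. (-1) ^ card t) = c * (\<Sum>s | s \<in> C \<and> s \<subseteq> A. (-1) ^ card s)"
proof -
  have "c * (\<Sum>s | s \<in> C \<and> s \<subseteq> A. (-1) ^ card s)
      = (\<Sum>s | s \<in> C \<and> s \<subseteq> A. \<Sum>t | t \<in> C \<and> s \<subseteq> t. (-1) ^ card s * (-1) ^ card t)"
    by (simp add: star mult.commute flip: sum_distrib_left sum_distrib_right)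
  also have "\<dots> = (\<Sum>t\<in>C. \<Sum>s | s \<in> {s \<in> C. s \<subseteq> A} \<and> s \<subseteq> t. (-1) ^ card s * (-1) ^ card t)"
    using assms(1) by (intro sum.swap_restrict) auto
  also have "\<dots> = (\<Sum>t\<in>C. if t \<inter> A = {} then (-1) ^ card t else 0)"
  proof (intro sum.cong refl)
    fix t assume t: "t \<in> C"
    then have "{s. s \<in> {s \<in> C. s \<subseteq> A} \<and> s \<subseteq> t} = Pow (t \<inter> A)" using down by auto
    then show "(\<Sum>s | s \<in> {s \<in> C. s \<subseteq> A} \<and> s \<subseteq> t. (-1) ^ card s * (-1::int) ^ card t)
        = (if t \<inter> A = {} then (-1) ^ card t else 0)"
      using sum_Pow_minus_one_card[of "t \<inter> A"] assms(2)[OF t] by (simp flip: sum_distrib_right)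
  qed
  finally show ?thesis using assms(1) by (simp add: sum.If_cases Int_def)
qed

section \<open>Cliques as vertex sets, and the Euler characteristic\<close>

definition cliques :: "('a, 'b) pre_digraph \<Rightarrow> 'a set set" where
  "cliques H = {s. s \<subseteq> verts H \<and> (\<forall>u\<in>s. \<forall>v\<in>s. u \<noteq> v \<longrightarrow> u \<rightarrow>\<^bsub>H\<^esub> v)}"

lemma cliques_downward: "t \<in> cliques H \<Longrightarrow> s \<subseteq> t \<Longrightarrow> s \<in> cliques H"
  unfolding cliques_def by blast

lemma empty_in_cliques [simp]: "{} \<in> cliques H"
  by (simp add: cliques_def)

lemma clique_subset_verts: "s \<in> cliques H \<Longrightarrow> s \<subseteq> verts H"
  by (simp add: cliques_def)

lemma (in fin_digraph) finite_cliques: "finite (cliques G)"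
  by (rule finite_subset[of _ "Pow (verts G)"]) (auto simp: cliques_def)

lemma (in fin_digraph) finite_clique: "s \<in> cliques G \<Longrightarrow> finite s"
  using clique_subset_verts finite_subset finite_verts by metis

lemma arcs_ends_induce_subgraph:
  "arcs_ends (H \<restriction> A) = {(u, v). u \<in> A \<and> v \<in> A \<and> u \<rightarrow>\<^bsub>H\<^esub> v}"
  by (auto simp: arcs_ends_conv)

lemma cliques_induce_subgraph:
  assumes "A \<subseteq> verts H"
  shows "cliques (H \<restriction> A) = {s \<in> cliques H. s \<subseteq> A}"
  using assms by (auto simp: cliques_def arcs_ends_induce_subgraph)

lemma (in graph) graph_induce_subgraph:
  assumes "A \<subseteq> verts G"
  shows "graph (G \<restriction> A)"
proof -
  have "induced_subgraph (G \<restriction> A) G" using assms by (rule induced_induce)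
  moreover from this have "digraph (G \<restriction> A)" by (rule digraphI_induced)
  ultimately show ?thesis
    by (auto simp: graph_def pseudo_graph_def digraph_def intro: induced_graph_imp_symmetric
        induced_graph_imp_graph sym_digraph.axioms)
qed

text \<open>Completeness gives a subgraph an arc between any two of its vertices, and as
  \<open>G\<close> has no parallel arcs this must be the arc of \<open>G\<close>. So complete
  subgraphs are induced, and inducing inverts \<open>verts\<close>.\<close>

lemma (in graph) bij_betw_complete_subgraphs_cliques:
  "bij_betw verts {K. subgraph K G \<and> K\<^bsub>n\<^esub> K} {s \<in> cliques G. card s = n}"
proof (rule bij_betw_byWitness[where f' = "\<lambda>s. G \<restriction> s"], goal_cases)
  case 1
  show ?case
  proof safe
    fix K assume K: "subgraph K G" "K\<^bsub>n\<^esub> K"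
    have "e \<in> arcs K" if e: "e \<in> arcs G" "tail G e \<in> verts K" "head G e \<in> verts K" for e
    proof -
      have "(tail G e, head G e) \<in> arcs_ends K"
        using K(2) e no_loops by (auto simp: complete_digraph_def)
      then obtain e' where "e' \<in> arcs K" "arc_to_ends K e' = (tail G e, head G e)"
        by (auto simp: arcs_ends_def)
      moreover from this have "e' = e"
        using K(1) e(1) by (intro no_multi_arcs) (auto simp: subgraph_def compatible_def arc_to_ends_def)
      ultimately show ?thesis by simp
    qed
    moreover have "tail G e \<in> verts K" "head G e \<in> verts K" "e \<in> arcs G" if "e \<in> arcs K" for e
      using K(1) that wf_digraph.wellformed[of K e] by (auto simp: subgraph_def compatible_def)
    ultimately have "arcs (G \<restriction> verts K) = arcs K" by auto
    then show "G \<restriction> verts K = K"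
      using K(1) by (auto simp: subgraph_def compatible_def intro: pre_digraph.equality)
  qed
next
  case 2
  show ?case by simp
next
  case 3
  have "verts K \<in> cliques G \<and> card (verts K) = n" if K: "subgraph K G" "K\<^bsub>n\<^esub> K" for K
  proof -
    have "u \<rightarrow>\<^bsub>G\<^esub> v" if "(u, v) \<in> arcs_ends K" for u v
      using that K(1) by (auto simp: subgraph_def compatible_def arcs_ends_conv)
    then show ?thesis using K by (auto simp: cliques_def complete_digraph_def subgraph_def)
  qed
  then show ?case by auto
next
  case 4
  have "subgraph (G \<restriction> s) G \<and> K\<^bsub>n\<^esub> (G \<restriction> s)" if s: "s \<in> cliques G" "card s = n" for s
  proof -
    have sub: "s \<subseteq> verts G" using s(1) by (rule clique_subset_verts)
    have "subgraph (G \<restriction> s) G"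
      using induced_induce[OF sub] by (rule induced_imp_subgraph)
    moreover have "arcs_ends (G \<restriction> s) = {(u, v). (u, v) \<in> s \<times> s \<and> u \<noteq> v}"
      using s(1) adj_not_same by (auto simp: arcs_ends_induce_subgraph cliques_def)
    ultimately show ?thesis
      using s(2) graph_induce_subgraph[OF sub] by (simp add: complete_digraph_def)
  qed
  then show ?case by auto
qed

text \<open>The reduced form of the Euler characteristic: the empty clique contributes the \<open>1\<close>.\<close>

lemma (in graph) sum_cliques_eq_euler_char:
  "(\<Sum>s\<in>cliques G. (-1) ^ card s) = 1 - euler_char G"
proof -
  let ?n = "card (verts G)"
  have num: "num_complete k G = card {s \<in> cliques G. card s = k + 1}" for k
    unfolding num_complete_def by (rule bij_betw_same_card[OF bij_betw_complete_subgraphs_cliques])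
  have "(\<Sum>s\<in>cliques G. (-1::int) ^ card s)
      = (\<Sum>k\<le>?n. \<Sum>s | s \<in> cliques G \<and> card s = k. (-1) ^ card s)"
    using clique_subset_verts by (intro sum.group[symmetric] finite_cliques) (auto intro!: card_mono)
  also have "\<dots> = (\<Sum>k\<le>?n. (-1) ^ k * int (card {s \<in> cliques G. card s = k}))"
    by (intro sum.cong refl) simp
  \<comment> \<open>\<open>num_complete k\<close> counts cliques with \<open>k + 1\<close> vertices;
    the index shift by one turns the remaining sum into minus the Euler characteristic.\<close>
  also have "\<dots> = int (card {s \<in> cliques G. card s = 0})
      + (\<Sum>k<?n. (-1) ^ Suc k * int (card {s \<in> cliques G. card s = Suc k}))"
    by (subst lessThan_Suc_atMost[symmetric], subst sum.lessThan_Suc_shift) simp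
  also have "{s \<in> cliques G. card s = 0} = {{}}"
    using finite_clique by auto
  finally show ?thesis by (simp add: euler_char_def num sum_negf)
qed

section \<open>Unit spheres as links in the clique complex, and star sums\<close>

lemma (in graph) cliques_unit_sphere:
  assumes "x \<in> verts G"
  shows "cliques (unit_sphere G x) = {s. x \<notin> s \<and> insert x s \<in> cliques G}"
proof -
  have sym: "u \<rightarrow>\<^bsub>G\<^esub> v \<Longrightarrow> v \<rightarrow>\<^bsub>G\<^esub> u" for u v
    using sym_arcs by (auto simp: symmetric_def dest: symD)
  have "cliques (unit_sphere G x) = {s \<in> cliques G. s \<subseteq> {y. x \<rightarrow>\<^bsub>G\<^esub> y}}"
    unfolding unit_sphere_def by (rule cliques_induce_subgraph) (auto simp: adj_in_verts)
  also have "\<dots> = {s. x \<notin> s \<and> insert x s \<in> cliques G}"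
    using assms sym by (auto simp: cliques_def dest: adj_not_same)
  finally show ?thesis .
qed

text \<open>For a clique \<open>s\<close> of a finite simple graph this is, up to sign, the reduced
  Euler characteristic of the link of \<open>s\<close> in the clique complex.\<close>

definition star_sum :: "('a, 'b) pre_digraph \<Rightarrow> 'a set \<Rightarrow> int" where
  "star_sum H s = (\<Sum>t | t \<in> cliques H \<and> s \<subseteq> t. (-1) ^ card t)"

lemma (in graph) star_sum_empty: "star_sum G {} = 1 - euler_char G"
  using sum_cliques_eq_euler_char by (simp add: star_sum_def)

text \<open>Deleting \<open>x\<close> is a bijection from the cliques through \<open>x\<close> to
  those of its unit sphere, and losing one vertex flips the sign.\<close>

lemma (in graph) star_sum_insert:
  assumes "x \<in> verts G" and "x \<notin> s"
  shows "star_sum G (insert x s) = - star_sum (unit_sphere G x) s"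
proof -
  have "star_sum G (insert x s)
      = (\<Sum>t | t \<in> cliques (unit_sphere G x) \<and> s \<subseteq> t. (-1) ^ card (insert x t))"
    unfolding star_sum_def cliques_unit_sphere[OF assms(1)]
  proof (rule sum.reindex_bij_witness[where i = "insert x" and j = "\<lambda>t. t - {x}"], goal_cases)
    case (2 t) then show ?case using assms(2) by (auto simp: insert_absorb)
  qed (use assms(2) in \<open>auto simp: insert_absorb\<close>)
  also have "\<dots> = (\<Sum>t | t \<in> cliques (unit_sphere G x) \<and> s \<subseteq> t. - ((-1) ^ card t))"
  proof (intro sum.cong refl)
    fix t assume "t \<in> {t \<in> cliques (unit_sphere G x). s \<subseteq> t}"
    then have t: "x \<notin> t" "insert x t \<in> cliques G" by (auto simp: cliques_unit_sphere[OF assms(1)])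
    then have "finite t" using finite_clique by fastforce
    then show "(-1::int) ^ card (insert x t) = - ((-1) ^ card t)" using t by simp
  qed
  finally show ?thesis by (simp add: star_sum_def sum_negf)
qed

section \<open>Lower bounds on the dimension, and graphs of dimension 0\<close>

lemma graph_dim_ge_minus_one: "- 1 \<le> graph_dim H"
  and graph_dim_nonneg: "graph H \<Longrightarrow> verts H \<noteq> {} \<Longrightarrow> 0 \<le> graph_dim H"
proof -
  have *: "- 1 \<le> graph_dim H \<and> (graph H \<and> verts H \<noteq> {} \<longrightarrow> 0 \<le> graph_dim H)"
  proof (induction H rule: graph_dim.induct)
    case (1 H)
    show ?case
    proof (cases "graph H \<and> verts H \<noteq> {}")
      case True
      then have "0 \<le> (\<Sum>x\<in>verts H. 1 + graph_dim (unit_sphere H x))"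
        using 1 by (intro sum_nonneg) fastforce
      with True have "0 \<le> graph_dim H" by (subst graph_dim.simps) simp
      then show ?thesis by simp
    qed (auto simp: graph_dim.simps)
  qed
  show "- 1 \<le> graph_dim H" using * by simp
  show "graph H \<Longrightarrow> verts H \<noteq> {} \<Longrightarrow> 0 \<le> graph_dim H" using * by simp
qed

text \<open>An average of nonnegative vertex dimensions vanishes only if each does, but a vertex
  with a neighbor has a nonempty unit sphere and hence dimension at least 1.\<close>

lemma (in graph) graph_dim_eq_0_imp_no_arcs:
  assumes "graph_dim G = 0"
  shows "\<not> u \<rightarrow>\<^bsub>G\<^esub> v"
proof
  assume uv: "u \<rightarrow>\<^bsub>G\<^esub> v"
  then have u: "u \<in> verts G" by (simp add: adj_in_verts)
  have nonneg: "0 \<le> vertex_dim G x" for x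
    using graph_dim_ge_minus_one[of "unit_sphere G x"] by (simp add: vertex_dim_def)
  have "graph_dim G = (\<Sum>x\<in>verts G. vertex_dim G x) / real (card (verts G))"
    using u graph_axioms by (intro graph_dim_average) auto
  then have "(\<Sum>x\<in>verts G. vertex_dim G x) = 0" using assms u by (auto simp: card_gt_0_iff)
  then have "vertex_dim G u = 0"
    using u nonneg by (subst (asm) sum_nonneg_eq_0_iff) auto
  moreover have "v \<in> verts (unit_sphere G u)" using uv by (simp add: unit_sphere_def)
  ultimately show False
    using graph_dim_nonneg[OF graph_unit_sphere, of u] by (auto simp: vertex_dim_def)
qed

text \<open>Splitting off one vertex \<open>x\<close> of \<open>s\<close> moves the claim into its
  unit sphere. There the Euler characteristic condition settles an empty remainder and the induction
  hypothesis a nonempty one. For \<open>s = {}\<close> the sum would involve the Euler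
  characteristic of \<open>H\<close> itself, which the definition does not prescribe
  directly.\<close>

lemma geometric_graph_star_sum:
  assumes "geometric_graph d H" and "graph H" and "s \<in> cliques H" and "s \<noteq> {}"
  shows "star_sum H s = (-1) ^ (d + 1)"
  using assms
proof (induction arbitrary: s rule: geometric_graph.induct)
  case (dim_1 H)
  interpret graph H by fact
  obtain x where "x \<in> s" using dim_1.prems by blast
  define r where "r = s - {x}"
  have s: "s = insert x r" "x \<notin> r" using \<open>x \<in> s\<close> by (auto simp: r_def)
  have x: "x \<in> verts H" using \<open>x \<in> s\<close> dim_1.prems clique_subset_verts by blast
  let ?S = "unit_sphere H x"
  interpret S: graph ?S by (rule graph_unit_sphere)
  have r: "r \<in> cliques ?S" using s dim_1.prems by (simp add: cliques_unit_sphere[OF x])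
  have "star_sum ?S r = - 1"
  proof (cases "r = {}")
    case True
    then show ?thesis using S.star_sum_empty dim_1.hyps x by simp
  next
    case False
    \<comment> \<open>The sphere is edgeless, so the nonempty clique \<open>r\<close> is a single
      vertex and no larger clique contains it.\<close>
    have "graph_dim ?S = 0" using dim_1.hyps x by (auto simp: vertex_dim_def)
    then have edgeless: "\<And>u v. \<not> u \<rightarrow>\<^bsub>?S\<^esub> v" by (rule S.graph_dim_eq_0_imp_no_arcs)
    from False obtain y where y: "y \<in> r" by blast
    have "t = {y}" if "t \<in> cliques ?S" "r \<subseteq> t" for t
    proof -
      have "y \<in> t" using that(2) y by blast
      moreover have "z = y" if "z \<in> t" for z
        using \<open>t \<in> cliques ?S\<close> that \<open>y \<in> t\<close> edgeless unfolding cliques_def by blast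
      ultimately show ?thesis by blast
    qed
    then have "{t. t \<in> cliques ?S \<and> r \<subseteq> t} = {{y}}" using r by blast
    then show ?thesis by (simp add: star_sum_def)
  qed
  then show ?case using star_sum_insert[OF x s(2)] s by simp
next
  case (dim_ge_2 d H)
  interpret graph H by fact
  obtain x where "x \<in> s" using dim_ge_2.prems by blast
  define r where "r = s - {x}"
  have s: "s = insert x r" "x \<notin> r" using \<open>x \<in> s\<close> by (auto simp: r_def)
  have x: "x \<in> verts H" using \<open>x \<in> s\<close> dim_ge_2.prems clique_subset_verts by blast
  let ?S = "unit_sphere H x"
  interpret S: graph ?S by (rule graph_unit_sphere)
  have r: "r \<in> cliques ?S" using s dim_ge_2.prems by (simp add: cliques_unit_sphere[OF x])
  \<comment> \<open>The prescribed Euler characteristic \<open>1 - (-1) ^ d\<close> is exactly what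
    makes the empty clique obey the same formula as the nonempty ones.\<close>
  have "star_sum ?S r = (-1) ^ d"
  proof (cases "r = {}")
    case True
    then show ?thesis using S.star_sum_empty dim_ge_2 x by simp
  next
    case False
    then have "star_sum ?S r = (-1) ^ (d - 1 + 1)"
      using dim_ge_2 x r S.graph_axioms by blast
    then show ?thesis using dim_ge_2.hyps by simp
  qed
  then show ?case using star_sum_insert[OF x s(2)] s by simp
qed

section \<open>Indices as clique sums, and their cancellation\<close>

lemma (in graph) index_eq_sum_cliques:
  "index G f x = (\<Sum>s | s \<in> cliques (unit_sphere G x) \<and> s \<subseteq> {y. f y < f x}. (-1) ^ card s)"
proof -
  let ?S = "unit_sphere G x"
  interpret S: graph ?S by (rule graph_unit_sphere)
  let ?A = "{y \<in> verts ?S. f y < f x}"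
  interpret A: graph "?S \<restriction> ?A" by (rule S.graph_induce_subgraph) auto
  have "cliques (?S \<restriction> ?A) = {s \<in> cliques ?S. s \<subseteq> ?A}" by (rule cliques_induce_subgraph) auto
  also have "\<dots> = {s. s \<in> cliques ?S \<and> s \<subseteq> {y. f y < f x}}" using clique_subset_verts by blast
  finally show ?thesis
    using A.sum_cliques_eq_euler_char by (simp add: index_def lower_sphere_def)
qed

theorem theorem1:
  fixes G :: "('a, 'b) pre_digraph" and d :: nat and f :: "'a \<Rightarrow> real"
  assumes "d \<ge> 1" and "odd d"
    and "graph G"
    and "geometric_graph d G"
    and "inj_on f (verts G)"
  shows "\<forall>x\<in>verts G. symmetric_index G f x = 0"
proof
  fix x assume x: "x \<in> verts G"
  interpret graph G by fact
  let ?S = "unit_sphere G x"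
  interpret S: graph ?S by (rule graph_unit_sphere)
  \<comment> \<open>This includes \<open>s = {}\<close>, since \<open>insert x s\<close> is nonempty
    in any case. As \<open>d\<close> is odd, its star sum in \<open>G\<close> is 1, and passing to
    the sphere flips the sign.\<close>
  have star: "star_sum ?S s = - 1" if "s \<in> cliques ?S" for s
    using that star_sum_insert[OF x, of s] assms geometric_graph_star_sum[of d G "insert x s"]
    by (simp add: cliques_unit_sphere[OF x])
  \<comment> \<open>By injectivity no vertex of the sphere lies at the level \<open>f x\<close>, so
    lying above it means avoiding the part below.\<close>
  have upper: "{s. s \<in> cliques ?S \<and> s \<subseteq> {y. - f y < - f x}}
      = {s. s \<in> cliques ?S \<and> s \<inter> {y. f y < f x} = {}}"
  proof -
    have "f y \<noteq> f x" if "y \<in> verts ?S" for y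
      using verts_unit_sphere_psubset[OF x] that x inj_onD[OF assms(5), of y x]
      by (auto simp: unit_sphere_def dest: adj_not_same)
    then have "f y \<noteq> f x" if "s \<in> cliques ?S" "y \<in> s" for s y
      using that clique_subset_verts by blast
    then show ?thesis by (fastforce simp: not_less less_le)
  qed
  \<comment> \<open>Duality in the sphere: the factor \<open>- 1\<close> is the constant star sum
    \<open>c\<close> of \<open>alternating_sum_avoiding\<close>, with the part below
    \<open>f x\<close> as \<open>A\<close>.\<close>
  have "index G (\<lambda>y. - f y) x = - 1 * index G f x"
    unfolding index_eq_sum_cliques upper
    using star S.finite_cliques S.finite_clique cliques_downward
    by (intro alternating_sum_avoiding) (auto simp: star_sum_def)
  then show "symmetric_index G f x = 0" by (simp add: symmetric_index_def)
qed

end
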